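(* Let $G=(V,E)$ be a finite connected graph. Then $G$ is lower conformally rigid if and only if there exist finitely many unit-length eigenvectors $\varphi_1,\dots,\varphi_r\in\mathcal{E}_{\lambda_2}$, a constant $c>0$, and coefficients $a_i\ge 0$ with $\sum_{i=1}^r a_i=1$ such that $$c\,\mathbf{1}=\sum_{i=1}^r a_i\,\ell(\varphi_i)=\sum_{i=1}^r a_i\big((\varphi_i(u)-\varphi_i(v))^2\big)_{uv\in E}$$ in $\mathbb{R}^E$. Likewise, $G$ is upper conformally rigid if and only if the same holds with $\mathcal{E}_{\lambda_n}$ in place of $\mathcal{E}_{\lambda_2}$.
   Context: $G=(V,E)$ is a finite, connected, simple undirected graph with $n=|V|\ge 2$ vertices. For edge weights $w:E\to\mathbb{R}$, $w\ge 0$, the weighted Laplacian $L(w)$ is the symmetric matrix with quadratic form $\langle\varphi,L(w)\varphi\rangle=\sum_{uv\in E}w_{uv}(\varphi(u)-\varphi(v))^2$ for $\varphi\in\mathbb{R}^V$, and its eigenvalues are $0=\lambda_1(w)\le\lambda_2(w)\le\cdots\le\lambda_n(w)$. Write $\mathbf{1}$ for the all-ones vector, $L=L(\mathbf{1})$, $\lambda_k=\lambda_k(\mathbf{1})$, and $\mathcal{E}_\lambda=\{\varphi\in\mathbb{R}^V: L\varphi=\lambda\varphi\}$. $G$ is lower conformally rigid if $\lambda_2(w)\le\lambda_2$ for all $w\ge 0$ with $\sum_{uv\in E}w_{uv}=|E|$; $G$ is upper conformally rigid if $\lambda_n(w)\ge\lambda_n$ for all $w\ge 0$ with $\sum_{uv\in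 E}w_{uv}=|E|$. For $\varphi:V\to\mathbb{R}$, the edge-energy vector is $\ell(\varphi)=\big((\varphi(u)-\varphi(v))^2\big)_{uv\in E}\in\mathbb{R}^E$. *)

theory Defs
  imports "HOL-Analysis.Analysis" "HOL-Library.Multiset"
begin

text \<open>The vertex set is the finite type \<open>'v\<close>; an edge is a two-element set of vertices, and
  \<open>\<real>\<^sup>V\<close> is \<^typ>\<open>real ^ 'v\<close>. Vectors in \<open>\<real>\<^sup>E\<close> are functions on \<^typ>\<open>'v set\<close> of which only the
  values on \<open>E\<close> are ever used.\<close>

definition simple_graph :: "'v set set \<Rightarrow> bool" where
  "simple_graph E \<longleftrightarrow> (\<forall>e\<in>E. \<exists>u v. u \<noteq> v \<and> e = {u, v})"

definition connected_graph :: "'v set set \<Rightarrow> bool" where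
  "connected_graph E \<longleftrightarrow> (\<forall>u v. (u, v) \<in> {(x, y). {x, y} \<in> E}\<^sup>*)"

definition edge_energy :: "real ^ 'v \<Rightarrow> 'v set \<Rightarrow> real" where
  "edge_energy \<phi> e = (THE r. \<exists>u v. e = {u, v} \<and> r = (\<phi> $ u - \<phi> $ v)\<^sup>2)"

lemma edge_energy_pair: "edge_energy \<phi> {u, v} = (\<phi> $ u - \<phi> $ v)\<^sup>2"
  unfolding edge_energy_def
proof (rule the_equality)
  fix r assume "\<exists>x y. {u, v} = {x, y} \<and> r = (\<phi> $ x - \<phi> $ y)\<^sup>2"
  then show "r = (\<phi> $ u - \<phi> $ v)\<^sup>2"
    by (auto simp: doubleton_eq_iff power2_commute)
qed blast

definition laplacian :: "'v::finite set set \<Rightarrow> ('v set \<Rightarrow> real) \<Rightarrow> real ^ 'v ^ 'v" where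
  "laplacian E w = (\<chi> u v. if u = v then (\<Sum>e | e \<in> E \<and> u \<in> e. w e)
                           else if {u, v} \<in> E then - w {u, v} else 0)"

text \<open>The Laplacian is the symmetric matrix with the quadratic form
  \<open>\<Sum>\<^bsub>uv \<in> E\<^esub> w\<^bsub>uv\<^esub> (\<phi>(u) - \<phi>(v))\<^sup>2\<close>; see also \<open>laplacian_unique\<close> below.\<close>

lemma transpose_laplacian: "transpose (laplacian E w) = laplacian E w"
proof -
  have "transpose (laplacian E w) $ x $ y = laplacian E w $ x $ y" for x y
    by (cases "x = y") (simp_all add: transpose_def laplacian_def insert_commute[of x y "{}"])
  then show ?thesis by (simp only: vec_eq_iff) blast
qed

lemma laplacian_entry:
  assumes "simple_graph E"
  shows "laplacian E w $ x $ y = (\<Sum>e\<in>E. w e * (if x \<in> e \<and> y \<in> e then if x = y then 1 else -1 else 0))"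
proof (cases "x = y")
  case True
  have "(\<Sum>e | e \<in> E \<and> y \<in> e. w e) = (\<Sum>e\<in>E. if y \<in> e then w e else 0)"
    by (rule sum.inter_filter) simp
  also have "\<dots> = (\<Sum>e\<in>E. w e * (if y \<in> e then 1 else 0))"
    by (rule sum.cong) simp_all
  finally show ?thesis unfolding True by (simp add: laplacian_def)
next
  case False
  have "(x \<in> e \<and> y \<in> e) = (e = {x, y})" if "e \<in> E" for e
  proof -
    from assms that obtain u v where "e = {u, v}" unfolding simple_graph_def by metis
    then show ?thesis using False by auto
  qed
  then have "(\<Sum>e\<in>E. w e * (if x \<in> e \<and> y \<in> e then if x = y then 1 else -1 else 0))
      = (\<Sum>e\<in>E. if e = {x, y} then - w {x, y} else 0)"
    using False by (intro sum.cong refl) simp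
  then show ?thesis using False by (simp add: laplacian_def)
qed

lemma laplacian_quadratic_form:
  assumes "simple_graph E"
  shows "\<phi> \<bullet> (laplacian E w *v \<phi>) = (\<Sum>e\<in>E. w e * edge_energy \<phi> e)"
proof -
  let ?s = "\<lambda>e x y. if x \<in> e \<and> y \<in> e then if x = y then 1 else (-1::real) else 0"
  have edge: "(\<Sum>x\<in>UNIV. \<Sum>y\<in>UNIV. \<phi> $ x * ?s e x y * \<phi> $ y) = edge_energy \<phi> e" if "e \<in> E" for e
  proof -
    obtain u v where uv: "u \<noteq> v" "e = {u, v}" using assms \<open>e \<in> E\<close> unfolding simple_graph_def by metis
    have "(\<Sum>x\<in>UNIV. \<Sum>y\<in>UNIV. \<phi> $ x * ?s e x y * \<phi> $ y) = (\<Sum>x\<in>{u,v}. \<Sum>y\<in>{u,v}. \<phi> $ x * ?s e x y * \<phi> $ y)"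
    proof (rule sum.mono_neutral_cong_right)
      show "(\<Sum>y\<in>UNIV. \<phi> $ x * ?s e x y * \<phi> $ y) = (\<Sum>y\<in>{u,v}. \<phi> $ x * ?s e x y * \<phi> $ y)" for x
        by (rule sum.mono_neutral_right) (auto simp: uv)
    qed (auto simp: uv)
    also have "\<dots> = edge_energy \<phi> e"
      using uv by (simp add: edge_energy_pair power2_eq_square algebra_simps)
    finally show ?thesis .
  qed
  have "\<phi> \<bullet> (laplacian E w *v \<phi>)
      = (\<Sum>x\<in>UNIV. \<Sum>y\<in>UNIV. \<Sum>e\<in>E. w e * (\<phi> $ x * ?s e x y * \<phi> $ y))"
    by (simp add: inner_vec_def matrix_vector_mult_def laplacian_entry[OF assms]
        sum_distrib_left sum_distrib_right mult_ac)
  also have "\<dots> = (\<Sum>e\<in>E. w e * (\<Sum>x\<in>UNIV. \<Sum>y\<in>UNIV. \<phi> $ x * ?s e x y * \<phi> $ y))"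
    unfolding sum_distrib_left
    by (rule trans[OF sum.cong[OF refl sum.swap] sum.swap])
  also have "\<dots> = (\<Sum>e\<in>E. w e * edge_energy \<phi> e)"
    by (rule sum.cong[OF refl]) (simp only: edge)
  finally show ?thesis .
qed

lemma laplacian_unique:
  fixes E :: "'v::finite set set" and A :: "real ^ 'v ^ 'v"
  assumes E: "simple_graph E" and A: "transpose A = A"
    and q: "\<And>\<phi>. \<phi> \<bullet> (A *v \<phi>) = (\<Sum>e\<in>E. w e * edge_energy \<phi> e)"
  shows "A = laplacian E w"
proof -
  let ?L = "laplacian E w"
  have polar: "2 * (x \<bullet> (B *v y)) = (x + y) \<bullet> (B *v (x + y)) - x \<bullet> (B *v x) - y \<bullet> (B *v y)"
    if "transpose B = B" for B :: "real ^ 'v ^ 'v" and x y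
  proof -
    have "y \<bullet> (B *v x) = x \<bullet> (B *v y)"
      using dot_lmul_matrix[of y B x] transpose_matrix_vector[of B y] that
      by (simp add: inner_commute)
    then show ?thesis by (simp add: matrix_vector_right_distrib inner_add_left inner_add_right)
  qed
  have "x \<bullet> (A *v y) = x \<bullet> (?L *v y)" for x y
    using polar[OF A, of x y] polar[OF transpose_laplacian, of x E w y]
    by (simp add: q laplacian_quadratic_form[OF E])
  then have "A *v y = ?L *v y" for y using vector_eq_ldot by blast
  then show ?thesis by (simp add: matrix_eq)
qed

definition eigenspace :: "real ^ 'n ^ 'n \<Rightarrow> real \<Rightarrow> (real ^ 'n) set" where
  "eigenspace A \<mu> = {x. A *v x = \<mu> *\<^sub>R x}"

text \<open>The eigenvalues in increasing order, each repeated according to its geometric multiplicity.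
  For symmetric \<open>A\<close>, the only case used, this list has length \<open>n\<close> and the geometric
  multiplicities are the algebraic ones. The index \<open>k\<close> of \<open>eigval A k\<close> runs from 1 to \<open>n\<close>.\<close>

definition eigval_list :: "real ^ 'n ^ 'n \<Rightarrow> real list" where
  "eigval_list A = sorted_list_of_multiset
     (\<Sum>\<mu> | eigenspace A \<mu> \<noteq> {0}. replicate_mset (dim (eigenspace A \<mu>)) \<mu>)"

definition eigval :: "real ^ 'n ^ 'n \<Rightarrow> nat \<Rightarrow> real" where
  "eigval A k = eigval_list A ! (k - 1)"

definition unit_weight :: "'v set \<Rightarrow> real" where
  "unit_weight e = 1"

definition normalized_weight :: "'v set set \<Rightarrow> ('v set \<Rightarrow> real) \<Rightarrow> bool" where
  "normalized_weight E w \<longleftrightarrow> (\<forall>e\<in>E. 0 \<le> w e) \<and> (\<Sum>e\<in>E. w e) = real (card E)"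

definition lower_conformally_rigid :: "'v::finite set set \<Rightarrow> bool" where
  "lower_conformally_rigid E \<longleftrightarrow>
     (\<forall>w. normalized_weight E w \<longrightarrow>
        eigval (laplacian E w) 2 \<le> eigval (laplacian E unit_weight) 2)"

definition upper_conformally_rigid :: "'v::finite set set \<Rightarrow> bool" where
  "upper_conformally_rigid E \<longleftrightarrow>
     (\<forall>w. normalized_weight E w \<longrightarrow>
        eigval (laplacian E w) CARD('v) \<ge> eigval (laplacian E unit_weight) CARD('v))"

end

theory Submission
  imports Defs
begin

text \<open>
  For a fixed vector \<open>x\<close> the energy \<open>\<Sum>\<^bsub>e \<in> E\<^esub> w\<^bsub>e\<^esub> \<ell>\<^bsub>e\<^esub>(x)\<close> is linear in \<open>w\<close>, and by the
  Courant--Fischer principle \<open>\<lambda>\<^sub>2(w)\<close> is its minimum over the unit vectors \<open>x \<bottom> 1\<close>, while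
  \<open>\<lambda>\<^sub>n(w)\<close> is its maximum over all unit vectors. Rigidity says that equal weights maximise the
  concave function \<open>\<lambda>\<^sub>2\<close>, or minimise the convex function \<open>\<lambda>\<^sub>n\<close>, on a simplex, and the theorem is
  the first-order condition for that: a constant vector has to lie in the convex hull of the
  gradients \<open>\<ell>(\<phi>)\<close> at the optimal \<open>\<phi>\<close>, which are the unit eigenvectors.

  A certificate implies rigidity because averaging the energies of the \<open>\<phi>\<^sub>i\<close> with the
  coefficients \<open>a\<^sub>i\<close> gives \<open>c \<cdot> |E|\<close> for every normalised \<open>w\<close>, and for \<open>w = 1\<close> this number is the
  eigenvalue itself; each \<open>\<phi>\<^sub>i\<close> is a test vector for the eigenvalue of \<open>w\<close>
  (\<open>certificate_imp_lower_rigid\<close>, \<open>certificate_imp_upper_rigid\<close>).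

  For the converse, suppose that the constant vector with entry sum \<open>\<lambda>\<close> is not in the convex hull
  of the \<open>\<ell>(\<phi>)\<close>. A separating hyperplane, shifted by a constant, yields a perturbation \<open>k\<close> of total
  weight 0 that strictly increases the energy of every optimal \<open>\<phi>\<close>. By compactness
  (\<open>perturbed_minimum\<close>) the weights \<open>1 + \<epsilon> k\<close> then raise the minimal energy, against rigidity. This
  is \<open>equal_weights_optimal_imp_balanced\<close>, stated for an arbitrary compact family of energies so
  that the upper case is the same lemma applied to \<open>- \<ell>\<close>.

  What connects this with eigenvalues counted in a sorted list is the spectral theorem
  (\<open>orthonormal_eigenbasis_exists\<close>), which identifies the list with the Rayleigh quotients of an
  orthonormal eigenbasis (\<open>eigval_list_eigenbasis\<close>).
\<close>

section \<open>The spectral theorem and the ordered list of eigenvalues\<close>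

text \<open>The residual \<open>r = f x - m x\<close> is half the gradient at \<open>x\<close> of the nonnegative form
  \<open>y \<bullet> f y - m (y \<bullet> y)\<close>, which vanishes at \<open>x\<close>; moving a little in the direction \<open>- r\<close>, which
  stays inside the invariant subspace, would make the form negative unless \<open>r = 0\<close>. The lemma drives
  the spectral theorem, and it later shows that optimal test vectors of the graph energies are
  eigenvectors.\<close>

lemma rayleigh_minimizer_is_eigenvector:
  fixes f :: "'a::real_inner \<Rightarrow> 'a"
  assumes f: "linear f" "\<And>x y. x \<bullet> f y = f x \<bullet> y"
    and S: "subspace S" "f ` S \<subseteq> S"
    and lb: "\<And>y. y \<in> S \<Longrightarrow> m * (y \<bullet> y) \<le> y \<bullet> f y"
    and x: "x \<in> S" "x \<bullet> f x = m * (x \<bullet> x)"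
  shows "f x = m *\<^sub>R x"
proof -
  define r where "r = f x - m *\<^sub>R x"
  have rS: "r \<in> S"
    unfolding r_def using S x by (intro subspace_diff subspace_scale) auto
  define d where "d = r \<bullet> f r - m * (r \<bullet> r)"
  have exp: "0 \<le> 2 * t * (r \<bullet> r) + t\<^sup>2 * d" for t
  proof -
    have "x + t *\<^sub>R r \<in> S" using S(1) rS x(1) by (intro subspace_add subspace_scale) auto
    note ineq = lb[OF this]
    have e: "f (x + t *\<^sub>R r) = f x + t *\<^sub>R f r"
      by (simp add: linear_add[OF f(1)] linear_scale[OF f(1)])
    have rr: "r \<bullet> r = r \<bullet> f x - m * (r \<bullet> x)"
      by (subst (2) r_def) (simp add: inner_diff_right)
    have "x \<bullet> f r = r \<bullet> f x" using f(2)[of x r] by (simp add: inner_commute)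
    then have lhs: "(x + t *\<^sub>R r) \<bullet> f (x + t *\<^sub>R r) = x \<bullet> f x + 2 * t * (r \<bullet> f x) + t\<^sup>2 * (r \<bullet> f r)"
      unfolding e by (simp add: inner_add_left inner_add_right algebra_simps power2_eq_square)
    have rhs: "(x + t *\<^sub>R r) \<bullet> (x + t *\<^sub>R r) = x \<bullet> x + 2 * t * (r \<bullet> x) + t\<^sup>2 * (r \<bullet> r)"
      by (simp add: inner_add_left inner_add_right algebra_simps power2_eq_square inner_commute)
    have "0 \<le> 2 * t * (r \<bullet> f x - m * (r \<bullet> x)) + t\<^sup>2 * d"
      using ineq unfolding lhs rhs x(2) d_def by (simp add: algebra_simps)
    then show ?thesis by (simp only: rr)
  qed
  \<comment> \<open>The linear term dominates for small negative \<open>t\<close>; the choice \<open>t = - k\<close> below makes the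
      quadratic term at most half of it.\<close>
  have "r \<bullet> r = 0"
  proof (rule ccontr)
    assume "r \<bullet> r \<noteq> 0"
    then have pos: "0 < r \<bullet> r" by simp
    define k where "k = (r \<bullet> r) / (\<bar>d\<bar> + 1)"
    have k: "0 < k" using pos by (simp add: k_def)
    have kd: "k * d \<le> r \<bullet> r"
    proof -
      have "k * d \<le> k * (\<bar>d\<bar> + 1)" using k by (intro mult_left_mono) auto
      also have "\<dots> = r \<bullet> r" by (simp add: k_def)
      finally show ?thesis .
    qed
    have "0 \<le> 2 * (- k) * (r \<bullet> r) + (- k)\<^sup>2 * d" by (rule exp)
    also have "\<dots> = k * (k * d - 2 * (r \<bullet> r))" by (simp add: power2_eq_square algebra_simps)
    also have "\<dots> < 0"
    proof (rule mult_pos_neg[OF k])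
      show "k * d - 2 * (r \<bullet> r) < 0" using kd pos by linarith
    qed
    finally show False by simp
  qed
  then show ?thesis by (simp add: r_def)
qed

text \<open>The eigenvalue of \<open>b\<close> is recovered as its Rayleigh quotient \<open>b \<bullet> f b\<close>, so that no separate
  eigenvalue function has to be carried along. The spanned subspace is left open, since bases of
  orthogonal complements are needed as well.\<close>

definition orthonormal_eigenbasis :: "('a::real_inner \<Rightarrow> 'a) \<Rightarrow> 'a set \<Rightarrow> bool" where
  "orthonormal_eigenbasis f B \<longleftrightarrow>
     pairwise orthogonal B \<and> (\<forall>b\<in>B. norm b = 1 \<and> f b = (b \<bullet> f b) *\<^sub>R b)"

lemma orthonormal_eigenbasis_independent:
  "orthonormal_eigenbasis f B \<Longrightarrow> independent B"
  by (rule pairwise_orthogonal_independent) (auto simp: orthonormal_eigenbasis_def)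

lemma orthonormal_eigenbasis_finite:
  fixes f :: "'a::euclidean_space \<Rightarrow> 'a"
  shows "orthonormal_eigenbasis f B \<Longrightarrow> finite B"
  using orthonormal_eigenbasis_independent independent_imp_finite by blast

lemma orthonormal_eigenbasis_insert:
  assumes B: "orthonormal_eigenbasis f B"
    and u: "norm u = 1" "f u = \<mu> *\<^sub>R u" "\<And>b. b \<in> B \<Longrightarrow> u \<bullet> b = 0"
  shows "orthonormal_eigenbasis f (insert u B)"
proof -
  have "u \<bullet> f u = \<mu>" using u(1,2) by (simp add: norm_eq_1)
  then show ?thesis using B u
    by (auto simp: orthonormal_eigenbasis_def pairwise_insert orthogonal_def inner_commute)
qed

lemma span_insert_orthogonal_complement:
  assumes S: "subspace S" "u \<in> S" and u: "norm u = 1"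
    and B: "span B = {y \<in> S. u \<bullet> y = 0}"
  shows "span (insert u B) = S"
proof
  have "B \<subseteq> S" using span_superset[of B] unfolding B by auto
  then show "span (insert u B) \<subseteq> S" using S by (intro span_minimal) auto
  show "S \<subseteq> span (insert u B)"
  proof
    fix y assume "y \<in> S"
    then have "y - (u \<bullet> y) *\<^sub>R u \<in> span B"
      unfolding B using S u by (auto intro!: subspace_diff subspace_scale simp: inner_diff_right norm_eq_1)
    then show "y \<in> span (insert u B)" by (auto simp: span_insert)
  qed
qed

lemma subspace_orthogonal_complement_in:
  "subspace S \<Longrightarrow> subspace {y \<in> S. u \<bullet> y = 0}"
  by (auto simp: subspace_def inner_add_right)

lemma invariant_orthogonal_complement:
  assumes "\<And>x y. x \<bullet> f y = f x \<bullet> y" "f u = \<mu> *\<^sub>R u" "f ` S \<subseteq> S"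
  shows "f ` {y \<in> S. u \<bullet> y = 0} \<subseteq> {y \<in> S. u \<bullet> y = 0}"
  using assms by auto

text \<open>The minimum of the Rayleigh quotient over the compact unit sphere of \<open>S\<close> is attained at an
  eigenvector \<open>u\<close>; the complement of \<open>u\<close> in \<open>S\<close> is again invariant, of smaller dimension.\<close>

theorem orthonormal_eigenbasis_exists:
  fixes f :: "'a::euclidean_space \<Rightarrow> 'a"
  assumes f: "linear f" "\<And>x y. x \<bullet> f y = f x \<bullet> y"
    and "subspace S" "f ` S \<subseteq> S"
  shows "\<exists>B. orthonormal_eigenbasis f B \<and> span B = S"
  using assms(3,4)
proof (induction "dim S" arbitrary: S rule: less_induct)
  case less
  note S = less.prems
  show ?case
  proof (cases "S = {0}")
    case True
    then have "orthonormal_eigenbasis f {} \<and> span {} = S"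
      by (simp add: orthonormal_eigenbasis_def)
    then show ?thesis ..
  next
    case False
    let ?U = "S \<inter> sphere 0 1"
    obtain y where y: "y \<in> S" "y \<noteq> 0" using False subspace_0[OF S(1)] by blast
    then have "y /\<^sub>R norm y \<in> ?U" using S(1) by (auto intro: subspace_scale)
    then have ne: "?U \<noteq> {}" by blast
    have "compact ?U" using closed_subspace[OF S(1)] by (intro closed_Int_compact) auto
    moreover have "continuous_on ?U (\<lambda>x. x \<bullet> f x)"
      using linear_continuous_on[OF linear_conv_bounded_linear[THEN iffD1, OF f(1)]]
      by (intro continuous_intros) auto
    ultimately obtain u where u: "u \<in> ?U" and min: "\<And>z. z \<in> ?U \<Longrightarrow> u \<bullet> f u \<le> z \<bullet> f z"
      using continuous_attains_inf[of ?U "\<lambda>x. x \<bullet> f x"] ne by blast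
    have lb: "(u \<bullet> f u) * (z \<bullet> z) \<le> z \<bullet> f z" if "z \<in> S" for z
    proof (cases "z = 0")
      case False
      have "z /\<^sub>R norm z \<in> ?U" using that False S(1) by (auto intro: subspace_scale)
      from min[OF this] have "u \<bullet> f u \<le> (z \<bullet> f z) / (z \<bullet> z)"
        by (simp add: linear_scale[OF f(1)] divide_inverse power2_norm_eq_inner[symmetric]
            power2_eq_square mult_ac)
      then show ?thesis using False by (simp add: field_simps)
    qed simp
    have fu: "f u = (u \<bullet> f u) *\<^sub>R u"
      using u by (intro rayleigh_minimizer_is_eigenvector[OF f S lb]) (auto simp: norm_eq_1)
    let ?T = "{y \<in> S. u \<bullet> y = 0}"
    have T: "subspace ?T" "f ` ?T \<subseteq> ?T"
      using subspace_orthogonal_complement_in[OF S(1)] invariant_orthogonal_complement[OF f(2) fu S(2)]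
      by auto
    have "u \<notin> ?T" using u by (auto simp: norm_eq_1)
    then have "?T \<subset> S" using u by blast
    then have "dim ?T < dim S"
      by (intro dim_psubset) (simp add: span_eq_iff[THEN iffD2, OF T(1)] span_eq_iff[THEN iffD2, OF S(1)])
    from less.hyps[OF this T] obtain B where B: "orthonormal_eigenbasis f B" "span B = ?T" by blast
    have "orthonormal_eigenbasis f (insert u B)"
      using u B span_superset[of B] by (intro orthonormal_eigenbasis_insert[OF B(1) _ fu]) auto
    moreover have "span (insert u B) = S"
      using u by (intro span_insert_orthogonal_complement[OF S(1) _ _ B(2)]) auto
    ultimately show ?thesis by blast
  qed
qed

lemma rayleigh_expansion:
  fixes f :: "'a::euclidean_space \<Rightarrow> 'a"
  assumes f: "linear f" and B: "orthonormal_eigenbasis f B" and x: "x \<in> span B"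
  shows "x \<bullet> f x = (\<Sum>b\<in>B. (b \<bullet> f b) * (x \<bullet> b)\<^sup>2)" and "x \<bullet> x = (\<Sum>b\<in>B. (x \<bullet> b)\<^sup>2)"
proof -
  have ex: "(\<Sum>b\<in>B. (x \<bullet> b) *\<^sub>R b) = x"
    using B x orthonormal_eigenbasis_finite[OF B]
    by (intro orthonormal_basis_expand) (auto simp: orthonormal_eigenbasis_def)
  have "f x = (\<Sum>b\<in>B. (x \<bullet> b) *\<^sub>R f b)"
    by (subst ex[symmetric]) (simp add: linear_sum[OF f] linear_scale[OF f])
  also have "\<dots> = (\<Sum>b\<in>B. (x \<bullet> b) *\<^sub>R (b \<bullet> f b) *\<^sub>R b)"
    using B by (intro sum.cong) (auto simp: orthonormal_eigenbasis_def)
  finally show "x \<bullet> f x = (\<Sum>b\<in>B. (b \<bullet> f b) * (x \<bullet> b)\<^sup>2)"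
    by (simp add: inner_sum_right power2_eq_square mult_ac)
  have "x \<bullet> x = x \<bullet> (\<Sum>b\<in>B. (x \<bullet> b) *\<^sub>R b)" by (simp only: ex)
  then show "x \<bullet> x = (\<Sum>b\<in>B. (x \<bullet> b)\<^sup>2)" by (simp add: inner_sum_right power2_eq_square)
qed

lemma selfadjoint_matrix:
  fixes A :: "real ^ 'n ^ 'n"
  assumes "transpose A = A"
  shows "x \<bullet> (A *v y) = (A *v x) \<bullet> y"
  using dot_lmul_matrix[of x A y] transpose_matrix_vector[of A x] assms by simp

text \<open>An eigenvector for \<open>\<mu>\<close> is orthogonal to every basis vector with a different eigenvalue, so its
  expansion uses only the basis vectors with eigenvalue \<open>\<mu>\<close>.\<close>

lemma eigenspace_eq_span_eigenbasis:
  fixes A :: "real ^ 'n ^ 'n"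
  assumes A: "transpose A = A"
    and B: "orthonormal_eigenbasis ((*v) A) B" "span B = UNIV"
  shows "eigenspace A \<mu> = span {b \<in> B. b \<bullet> (A *v b) = \<mu>}"
proof
  have "subspace (eigenspace A \<mu>)"
    by (auto simp: subspace_def eigenspace_def matrix_vector_right_distrib matrix_vector_mult_scaleR algebra_simps)
  moreover have "{b \<in> B. b \<bullet> (A *v b) = \<mu>} \<subseteq> eigenspace A \<mu>"
    using B(1) by (auto simp: orthonormal_eigenbasis_def eigenspace_def)
  ultimately show "span {b \<in> B. b \<bullet> (A *v b) = \<mu>} \<subseteq> eigenspace A \<mu>" by (intro span_minimal)
  show "eigenspace A \<mu> \<subseteq> span {b \<in> B. b \<bullet> (A *v b) = \<mu>}"
  proof
    fix x assume x: "x \<in> eigenspace A \<mu>"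
    have fin: "finite B" using orthonormal_eigenbasis_finite[OF B(1)] .
    have zero: "x \<bullet> b = 0" if b: "b \<in> B" "b \<bullet> (A *v b) \<noteq> \<mu>" for b
    proof -
      have "A *v b = (b \<bullet> (A *v b)) *\<^sub>R b" using B(1) b by (auto simp: orthonormal_eigenbasis_def)
      then have "x \<bullet> (A *v b) = (b \<bullet> (A *v b)) * (x \<bullet> b)" by (metis inner_scaleR_right)
      moreover have "x \<bullet> (A *v b) = \<mu> * (x \<bullet> b)"
        using x by (simp add: selfadjoint_matrix[OF A] eigenspace_def)
      ultimately show ?thesis using b by auto
    qed
    have "x = (\<Sum>b\<in>B. (x \<bullet> b) *\<^sub>R b)"
      using B fin by (intro orthonormal_basis_expand[symmetric]) (auto simp: orthonormal_eigenbasis_def)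
    also have "\<dots> = (\<Sum>b | b \<in> B \<and> b \<bullet> (A *v b) = \<mu>. (x \<bullet> b) *\<^sub>R b)"
      using fin zero by (intro sum.mono_neutral_right) auto
    also have "\<dots> \<in> span {b \<in> B. b \<bullet> (A *v b) = \<mu>}"
      by (intro span_sum span_scale span_base) auto
    finally show "x \<in> span {b \<in> B. b \<bullet> (A *v b) = \<mu>}" .
  qed
qed

text \<open>The multiplicity of \<open>\<mu>\<close> on both sides is the dimension of the eigenspace of \<open>\<mu>\<close>, since the basis
  vectors with eigenvalue \<open>\<mu>\<close> are a basis of it.\<close>

lemma eigval_list_eigenbasis:
  fixes A :: "real ^ 'n ^ 'n"
  assumes A: "transpose A = A"
    and B: "orthonormal_eigenbasis ((*v) A) B" "span B = UNIV"
  shows "eigval_list A =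
    sorted_list_of_multiset (image_mset (\<lambda>b. b \<bullet> (A *v b)) (mset_set B))"
proof -
  let ?ev = "\<lambda>b. b \<bullet> (A *v b)"
  let ?M = "{\<mu>. eigenspace A \<mu> \<noteq> {0}}"
  have fin: "finite B" using orthonormal_eigenbasis_finite[OF B(1)] .
  have dim: "dim (eigenspace A \<mu>) = card {b \<in> B. ?ev b = \<mu>}" for \<mu>
    unfolding eigenspace_eq_span_eigenbasis[OF A B]
    by (rule dim_span_eq_card_independent)
      (rule independent_mono[OF orthonormal_eigenbasis_independent[OF B(1)]], auto)
  have triv: "eigenspace A \<mu> = {0} \<longleftrightarrow> {b \<in> B. ?ev b = \<mu>} = {}" for \<mu>
  proof
    assume "eigenspace A \<mu> = {0}"
    then have "card {b \<in> B. ?ev b = \<mu>} = 0" using dim[of \<mu>] by simp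
    then show "{b \<in> B. ?ev b = \<mu>} = {}" using fin by simp
  qed (simp add: eigenspace_eq_span_eigenbasis[OF A B] del: empty_Collect_eq Collect_empty_eq)
  have M: "?M = ?ev ` B" using triv by auto
  have "(\<Sum>\<mu>\<in>?M. replicate_mset (dim (eigenspace A \<mu>)) \<mu>) = image_mset ?ev (mset_set B)"
  proof (rule multiset_eqI)
    fix \<nu>
    have "count (\<Sum>\<mu>\<in>?M. replicate_mset (dim (eigenspace A \<mu>)) \<mu>) \<nu>
        = (\<Sum>\<mu>\<in>?M. if \<mu> = \<nu> then card {b \<in> B. ?ev b = \<nu>} else 0)"
      unfolding count_sum by (intro sum.cong) (auto simp: dim)
    also have "\<dots> = (if \<nu> \<in> ?M then card {b \<in> B. ?ev b = \<nu>} else 0)"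
      unfolding M using fin by (intro sum.delta) auto
    also have "\<dots> = card {b \<in> B. ?ev b = \<nu>}"
      using triv[of \<nu>] by (auto simp del: empty_Collect_eq Collect_empty_eq)
    also have "\<dots> = count (image_mset ?ev (mset_set B)) \<nu>"
    proof -
      have "?ev -` {\<nu>} \<inter> set_mset (mset_set B) = {b \<in> B. ?ev b = \<nu>}" using fin by auto
      then show ?thesis using fin by (simp add: count_image_mset count_mset_set')
    qed
    finally show "count (\<Sum>\<mu>\<in>?M. replicate_mset (dim (eigenspace A \<mu>)) \<mu>) \<nu>
        = count (image_mset ?ev (mset_set B)) \<nu>" .
  qed
  then show ?thesis by (simp add: eigval_list_def)
qed

lemma card_orthonormal_eigenbasis:
  fixes A :: "real ^ 'n ^ 'n"
  assumes "orthonormal_eigenbasis ((*v) A) B" "span B = UNIV"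
  shows "card B = CARD('n)"
  using dim_eq_card[of B UNIV] assms(2) orthonormal_eigenbasis_independent[OF assms(1)] by simp

text \<open>Being last in the sorted list, this eigenvalue bounds the Rayleigh quotients of all basis
  vectors, and every other Rayleigh quotient is a weighted average of those.\<close>

lemma largest_eigval_variational:
  fixes A :: "real ^ 'n ^ 'n"
  assumes A: "transpose A = A"
  shows "\<exists>x. norm x = 1 \<and> x \<bullet> (A *v x) = eigval A CARD('n)"
    and "x \<bullet> (A *v x) \<le> eigval A CARD('n) * (x \<bullet> x)"
proof -
  let ?ev = "\<lambda>b. b \<bullet> (A *v b)" and ?v = "eigval A CARD('n)"
  have lin: "linear ((*v) A)" by simp
  obtain B where B: "orthonormal_eigenbasis ((*v) A) B" "span B = UNIV"
    using orthonormal_eigenbasis_exists[OF lin selfadjoint_matrix[OF A] subspace_UNIV] by auto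
  have fin: "finite B" using orthonormal_eigenbasis_finite[OF B(1)] .
  define xs where "xs = eigval_list A"
  have set: "set xs = ?ev ` B" and sorted: "sorted xs"
    using fin by (simp_all add: xs_def eigval_list_eigenbasis[OF A B])
  have "length xs = size (mset xs)" by simp
  also have "\<dots> = CARD('n)"
    by (simp add: xs_def eigval_list_eigenbasis[OF A B] card_orthonormal_eigenbasis[OF B] del: size_mset)
  finally have len: "length xs = CARD('n)" .
  have v: "?v = xs ! (CARD('n) - 1)" by (simp add: eigval_def xs_def)
  have "?v \<in> set xs" unfolding v using len by (intro nth_mem) simp
  then obtain b where b: "b \<in> B" "?v = ?ev b" unfolding set by blast
  then show "\<exists>x. norm x = 1 \<and> x \<bullet> (A *v x) = ?v"
    using B(1) by (auto simp: orthonormal_eigenbasis_def)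
  have max: "?ev b \<le> ?v" if b: "b \<in> B" for b
  proof -
    obtain i where i: "i < length xs" "?ev b = xs ! i"
      using b set by (metis imageI in_set_conv_nth)
    then show ?thesis unfolding v i(2) using len sorted
      by (intro sorted_nth_mono) auto
  qed
  have x: "x \<in> span B" using B(2) by simp
  show "x \<bullet> (A *v x) \<le> ?v * (x \<bullet> x)"
    unfolding rayleigh_expansion[OF lin B(1) x] sum_distrib_left
    by (intro sum_mono mult_right_mono max) auto
qed

text \<open>The eigenbasis is chosen to contain the normalised \<open>u\<close>. Its eigenvalue is a lowest one, hence
  can be taken as the head of the sorted list, and the remaining list belongs to an eigenbasis of
  the complement of \<open>u\<close>. This covers the case that \<open>\<mu>\<close> is a multiple eigenvalue, which occurs for
  weights that disconnect the graph.\<close>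

lemma second_eigval_variational:
  fixes A :: "real ^ 'n ^ 'n"
  assumes A: "transpose A = A" and n: "2 \<le> CARD('n)"
    and u: "u \<noteq> 0" "A *v u = \<mu> *\<^sub>R u"
    and lowest: "\<And>x. \<mu> * (x \<bullet> x) \<le> x \<bullet> (A *v x)"
  shows "\<exists>x. norm x = 1 \<and> u \<bullet> x = 0 \<and> x \<bullet> (A *v x) = eigval A 2"
    and "u \<bullet> x = 0 \<Longrightarrow> eigval A 2 * (x \<bullet> x) \<le> x \<bullet> (A *v x)"
proof -
  let ?ev = "\<lambda>b. b \<bullet> (A *v b)" and ?v = "eigval A 2"
  define u' where "u' = u /\<^sub>R norm u"
  have u': "norm u' = 1" "A *v u' = \<mu> *\<^sub>R u'"
    using u by (simp_all add: u'_def matrix_vector_mult_scaleR)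
  have orth: "u' \<bullet> x = 0 \<longleftrightarrow> u \<bullet> x = 0" for x using u by (simp add: u'_def)
  have lin: "linear ((*v) A)" by simp
  let ?T = "{y \<in> UNIV. u' \<bullet> y = 0}"
  have T: "subspace ?T" "(*v) A ` ?T \<subseteq> ?T"
    using subspace_orthogonal_complement_in[OF subspace_UNIV]
      invariant_orthogonal_complement[OF selfadjoint_matrix[OF A] u'(2) subset_UNIV] by auto
  obtain B where B: "orthonormal_eigenbasis ((*v) A) B" "span B = ?T"
    using orthonormal_eigenbasis_exists[OF lin selfadjoint_matrix[OF A] T] by blast
  have perp: "u' \<bullet> b = 0" if "b \<in> B" for b using that B(2) span_superset[of B] by auto
  then have notin: "u' \<notin> B" using u'(1) by (auto simp: norm_eq_1)
  have B': "orthonormal_eigenbasis ((*v) A) (insert u' B)" "span (insert u' B) = UNIV"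
    using orthonormal_eigenbasis_insert[OF B(1) u' perp]
      span_insert_orthogonal_complement[OF subspace_UNIV UNIV_I u'(1) B(2)] by auto
  have fin: "finite B" using orthonormal_eigenbasis_finite[OF B(1)] .
  define xs where "xs = sorted_list_of_multiset (image_mset ?ev (mset_set B))"
  have set: "set xs = ?ev ` B" and sorted: "sorted xs" using fin by (simp_all add: xs_def)
  have "length xs = size (mset xs)" by simp
  also have "\<dots> = card B" by (simp add: xs_def del: size_mset)
  finally have len: "length xs = card B" .
  have "card B = CARD('n) - 1"
    using card_orthonormal_eigenbasis[OF B'] fin notin by simp
  then have len0: "0 < length xs" using len n by simp
  have low: "?ev u' \<le> ?ev b" if "b \<in> B" for b
  proof -
    have "?ev u' = \<mu>" using u' by (simp add: norm_eq_1)
    also have "\<mu> \<le> ?ev b" using lowest[of b] B(1) that by (auto simp: orthonormal_eigenbasis_def norm_eq_1)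
    finally show ?thesis .
  qed
  have "eigval_list A = ?ev u' # xs"
    using fin notin low set
    by (simp add: eigval_list_eigenbasis[OF A B'] xs_def[symmetric] insort_is_Cons)
  then have v: "?v = xs ! 0" by (simp add: eigval_def)
  have "?v \<in> set xs" unfolding v using len0 by (rule nth_mem)
  then obtain b where b: "b \<in> B" "?v = ?ev b" unfolding set by blast
  then show "\<exists>x. norm x = 1 \<and> u \<bullet> x = 0 \<and> x \<bullet> (A *v x) = ?v"
    using B(1) perp by (auto simp: orthonormal_eigenbasis_def orth)
  have min: "?v \<le> ?ev b" if b: "b \<in> B" for b
  proof -
    obtain i where i: "i < length xs" "?ev b = xs ! i"
      using b set by (metis imageI in_set_conv_nth)
    then show ?thesis unfolding v i(2) using sorted by (intro sorted_nth_mono) auto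
  qed
  assume "u \<bullet> x = 0"
  then have x: "x \<in> span B" unfolding B(2) by (simp add: orth)
  show "?v * (x \<bullet> x) \<le> x \<bullet> (A *v x)"
    unfolding rayleigh_expansion[OF lin B(1) x] sum_distrib_left
    by (intro sum_mono mult_right_mono min) auto
qed

section \<open>Optimality of equal weights\<close>

text \<open>Where \<open>g > 0\<close>, any positive multiple of \<open>g\<close> lifts \<open>f\<close> strictly above \<open>m\<close>. The remaining
  points form a compact set on which \<open>f\<close> stays away from \<open>m\<close>, by a gap that a small multiple of
  the bounded function \<open>g\<close> cannot close.\<close>

lemma perturbed_minimum:
  fixes f g :: "'a::t2_space \<Rightarrow> real"
  assumes U: "compact U" and f: "continuous_on U f" and g: "continuous_on U g"
    and lb: "\<And>x. x \<in> U \<Longrightarrow> m \<le> f x"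
    and pos: "\<And>x. x \<in> U \<Longrightarrow> f x = m \<Longrightarrow> 0 < g x"
  shows "\<exists>\<epsilon>0>0. \<forall>\<epsilon>. 0 < \<epsilon> \<and> \<epsilon> \<le> \<epsilon>0 \<longrightarrow> (\<forall>x\<in>U. m < f x + \<epsilon> * g x)"
proof (cases "\<exists>x\<in>U. g x \<le> 0")
  case False
  then have "\<forall>x\<in>U. m < f x + \<epsilon> * g x" if "0 < \<epsilon>" for \<epsilon>
    using lb that by (metis add_le_less_mono add.right_neutral mult_pos_pos not_le)
  then show ?thesis by (intro exI[of _ 1]) auto
next
  case True
  define C where "C = {x \<in> U. g x \<le> 0}"
  have "closedin (top_of_set U) (U \<inter> g -` {..0})"
    by (rule continuous_closedin_preimage[OF g]) simp
  then have C: "compact C" "C \<noteq> {}"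
    using U True closedin_compact by (auto simp: C_def vimage_def Int_def)
  have sub: "C \<subseteq> U" by (auto simp: C_def)
  obtain p where p: "p \<in> C" "\<And>y. y \<in> C \<Longrightarrow> f p \<le> f y"
    using continuous_attains_inf[OF C continuous_on_subset[OF f sub]] by blast
  obtain q where q: "q \<in> C" "\<And>y. y \<in> C \<Longrightarrow> g q \<le> g y"
    using continuous_attains_inf[OF C continuous_on_subset[OF g sub]] by blast
  have gap: "m < f p" using p(1) lb[of p] pos[of p] by (force simp: C_def)
  \<comment> \<open>Since \<open>g q\<close> is the minimum of \<open>g\<close> on \<open>C\<close>, the number \<open>D\<close> bounds \<open>- g\<close> there; the 1 keeps
      it positive. With \<open>\<epsilon>0\<close> at most half of the gap \<open>f p - m\<close> is lost.\<close>
  define D where "D = 1 - g q"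
  have D: "0 < D" using q(1) by (simp add: C_def D_def)
  define \<epsilon>0 where "\<epsilon>0 = (f p - m) / (2 * D)"
  have e0: "0 < \<epsilon>0" using gap D by (simp add: \<epsilon>0_def)
  have "m < f x + \<epsilon> * g x" if \<epsilon>: "0 < \<epsilon>" "\<epsilon> \<le> \<epsilon>0" and x: "x \<in> U" for \<epsilon> x
  proof (cases "x \<in> C")
    case False
    then show ?thesis using lb[OF x] x \<epsilon> by (auto simp: C_def intro: add_le_less_mono[of m _ 0, simplified])
  next
    case True
    have "\<epsilon> * (- g x) \<le> \<epsilon>0 * D"
      using True q(2)[OF True] \<epsilon> e0 by (intro mult_mono) (auto simp: C_def D_def)
    also have "\<dots> = (f p - m) / 2" using D by (simp add: \<epsilon>0_def)
    also have "\<dots> < f p - m" using gap by simp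
    also have "\<dots> \<le> f x - m" using p(2)[OF True] by simp
    finally show ?thesis by simp
  qed
  then show ?thesis using e0 by blast
qed

text \<open>A theorem of the alternative: \<open>F x i\<close> is the energy of \<open>x\<close> on \<open>i\<close>, and \<open>opt\<close> says that no
  reweighting of the same total raises the minimal energy above \<open>m\<close>. If no mixture of minimisers
  had equal energy on all indices, separating the constant vector \<open>z\<close> from the convex hull of
  the energy vectors of the minimisers would provide such a reweighting.\<close>

lemma equal_weights_optimal_imp_balanced:
  fixes F :: "'a::t2_space \<Rightarrow> 'i::finite \<Rightarrow> real"
  assumes U: "compact U" and cont: "\<And>i. i \<in> I \<Longrightarrow> continuous_on U (\<lambda>x. F x i)"
    and I: "I \<noteq> {}"
    and lb: "\<And>x. x \<in> U \<Longrightarrow> m \<le> (\<Sum>i\<in>I. F x i)"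
    and opt: "\<And>w. (\<forall>i\<in>I. 0 \<le> w i) \<Longrightarrow> (\<Sum>i\<in>I. w i) = real (card I) \<Longrightarrow>
                 \<exists>x\<in>U. (\<Sum>i\<in>I. w i * F x i) \<le> m"
  obtains r :: nat and x a where
    "\<forall>j\<in>{1..r}. x j \<in> U \<and> (\<Sum>i\<in>I. F (x j) i) = m"
    "\<forall>j\<in>{1..r}. 0 \<le> a j" "(\<Sum>j=1..r. a j) = 1"
    "\<forall>i\<in>I. m / real (card I) = (\<Sum>j=1..r. a j * F (x j) i)"
proof -
  define V :: "'a \<Rightarrow> real ^ 'i" where "V x = (\<chi> i. if i \<in> I then F x i else 0)" for x
  define K where "K = {x \<in> U. (\<Sum>i\<in>I. F x i) = m}"
  define z :: "real ^ 'i" where "z = (\<chi> i. if i \<in> I then m / real (card I) else 0)"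
  have N: "0 < real (card I)" using I by (simp add: card_gt_0_iff)
  have contsum: "continuous_on U (\<lambda>x. \<Sum>i\<in>I. F x i)" by (intro continuous_intros cont)
  have "closedin (top_of_set U) (U \<inter> (\<lambda>x. \<Sum>i\<in>I. F x i) -` {m})"
    by (rule continuous_closedin_preimage[OF contsum]) simp
  then have K: "compact K"
    using U closedin_compact by (auto simp: K_def vimage_def Int_def)
  have "continuous_on K (\<lambda>x. if i \<in> I then F x i else 0)" for i
    using continuous_on_subset[OF cont, of i K] by (cases "i \<in> I") (auto simp: K_def)
  then have "continuous_on K V" unfolding V_def by (rule continuous_on_vec_lambda)
  then have hull: "compact (convex hull (V ` K))"
    using K by (intro compact_convex_hull compact_continuous_image)
  have dotV: "h \<bullet> V x = (\<Sum>i\<in>I. h $ i * F x i)" for h x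
    by (simp add: inner_vec_def V_def if_distrib sum.If_cases cong: if_cong)
  have dotz: "h \<bullet> z = (\<Sum>i\<in>I. h $ i) * (m / real (card I))" for h
    by (simp add: inner_vec_def z_def if_distrib sum.If_cases sum_distrib_right sum_divide_distrib cong: if_cong)
  have "z \<in> convex hull (V ` K)"
  proof (rule ccontr)
    assume "z \<notin> convex hull (V ` K)"
    then obtain h b where h: "h \<bullet> z < b" "\<And>y. y \<in> convex hull (V ` K) \<Longrightarrow> b < h \<bullet> y"
      using separating_hyperplane_closed_point[OF convex_convex_hull compact_imp_closed[OF hull]] by blast
    \<comment> \<open>Subtracting the mean from the normal vector \<open>h\<close> makes the perturbation \<open>k\<close> preserve the total
        weight. It also turns separation from \<open>z\<close> into separation from 0, because all energy vectors
        of minimisers have the same entry sum \<open>m\<close> as \<open>z\<close>.\<close>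
    define t where "t = (\<Sum>i\<in>I. h $ i) / real (card I)"
    define k where "k i = h $ i - t" for i
    have ksum: "(\<Sum>i\<in>I. k i) = 0" using N by (simp add: k_def sum_subtractf t_def)
    have kpos: "0 < (\<Sum>i\<in>I. k i * F x i)" if x: "x \<in> U" "(\<Sum>i\<in>I. F x i) = m" for x
    proof -
      have "V x \<in> convex hull (V ` K)" using x by (intro hull_inc) (auto simp: K_def)
      then have "h \<bullet> z < h \<bullet> V x" using h by fastforce
      moreover have "(\<Sum>i\<in>I. k i * F x i) = h \<bullet> V x - t * m"
        by (simp add: k_def left_diff_distrib sum_subtractf dotV x(2)[symmetric] sum_distrib_left)
      ultimately show ?thesis by (simp add: dotz t_def)
    qed
    have contk: "continuous_on U (\<lambda>x. \<Sum>i\<in>I. k i * F x i)" by (intro continuous_intros cont)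
    obtain \<epsilon>0 where \<epsilon>0: "0 < \<epsilon>0"
      "\<And>\<epsilon> x. 0 < \<epsilon> \<Longrightarrow> \<epsilon> \<le> \<epsilon>0 \<Longrightarrow> x \<in> U \<Longrightarrow> m < (\<Sum>i\<in>I. F x i) + \<epsilon> * (\<Sum>i\<in>I. k i * F x i)"
      using perturbed_minimum[OF U contsum contk lb kpos] by blast
    define s where "s = (\<Sum>i\<in>I. \<bar>k i\<bar>) + 1"
    have s: "0 < s" unfolding s_def by (intro add_nonneg_pos sum_nonneg) auto
    have ks: "\<bar>k i\<bar> \<le> s" if "i \<in> I" for i
    proof -
      have "\<bar>k i\<bar> \<le> (\<Sum>i\<in>I. \<bar>k i\<bar>)" using that by (intro member_le_sum) auto
      then show ?thesis by (simp add: s_def)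
    qed
    \<comment> \<open>The bound \<open>1 / s\<close> keeps the perturbed weights nonnegative.\<close>
    define \<epsilon> where "\<epsilon> = min \<epsilon>0 (1 / s)"
    have \<epsilon>: "0 < \<epsilon>" "\<epsilon> \<le> \<epsilon>0" "\<epsilon> * s \<le> 1"
      using \<epsilon>0(1) s by (auto simp: \<epsilon>_def min_def field_simps)
    define w where "w i = 1 + \<epsilon> * k i" for i
    have "0 \<le> w i" if "i \<in> I" for i
    proof -
      have "\<epsilon> * (- k i) \<le> \<epsilon> * s" using ks[OF that] \<epsilon>(1) by (intro mult_left_mono) auto
      then show ?thesis using \<epsilon>(3) by (simp add: w_def)
    qed
    moreover have "(\<Sum>i\<in>I. w i) = real (card I)"
      by (simp add: w_def sum.distrib sum_distrib_left[symmetric] ksum)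
    ultimately obtain x where x: "x \<in> U" "(\<Sum>i\<in>I. w i * F x i) \<le> m" using opt by blast
    have "(\<Sum>i\<in>I. w i * F x i) = (\<Sum>i\<in>I. F x i) + \<epsilon> * (\<Sum>i\<in>I. k i * F x i)"
      by (simp add: w_def distrib_right sum.distrib sum_distrib_left mult.assoc)
    then show False using \<epsilon>0(2)[OF \<epsilon>(1,2) x(1)] x(2) by simp
  qed
  then obtain r a y where y: "\<forall>j\<in>{1::nat..r}. 0 \<le> a j \<and> y j \<in> V ` K"
    "sum a {1..r} = 1" "(\<Sum>j=1..r. a j *\<^sub>R y j) = z"
    unfolding convex_hull_indexed by blast
  have "\<forall>j\<in>{1..r}. \<exists>p. p \<in> K \<and> V p = y j" using y(1) by (metis imageE)
  then obtain x where x: "x j \<in> K \<and> V (x j) = y j" if "j \<in> {1..r}" for j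
    by (metis (no_types))
  have bal: "m / real (card I) = (\<Sum>j=1..r. a j * F (x j) i)" if "i \<in> I" for i
  proof -
    have "m / real (card I) = (\<Sum>j=1..r. a j *\<^sub>R y j) $ i"
      unfolding y(3) using that by (simp add: z_def)
    also have "\<dots> = (\<Sum>j=1..r. a j * y j $ i)" by simp
    also have "\<dots> = (\<Sum>j=1..r. a j * F (x j) i)"
    proof (rule sum.cong[OF refl])
      fix j assume "j \<in> {1..r}"
      then have "y j = V (x j)" using x by simp
      then show "a j * y j $ i = a j * F (x j) i" using that by (simp add: V_def)
    qed
    finally show ?thesis .
  qed
  show thesis
  proof (rule that)
    show "\<forall>j\<in>{1..r}. x j \<in> U \<and> (\<Sum>i\<in>I. F (x j) i) = m"
      using x unfolding K_def by blast
    show "\<forall>j\<in>{1..r}. 0 \<le> a j" using y(1) by blast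
    show "(\<Sum>j=1..r. a j) = 1" by (rule y(2))
    show "\<forall>i\<in>I. m / real (card I) = (\<Sum>j=1..r. a j * F (x j) i)" using bal by blast
  qed
qed

section \<open>Laplacian eigenvalues of a weighted graph\<close>

lemma edge_energy_nonneg: "simple_graph E \<Longrightarrow> e \<in> E \<Longrightarrow> 0 \<le> edge_energy x e"
  unfolding simple_graph_def by (metis edge_energy_pair zero_le_power2)

lemma continuous_on_edge_energy:
  assumes "simple_graph E" "e \<in> E"
  shows "continuous_on U (\<lambda>x. edge_energy x e)"
proof -
  obtain u v where "e = {u, v}" using assms unfolding simple_graph_def by metis
  then show ?thesis by (simp add: edge_energy_pair) (intro continuous_intros)
qed

text \<open>The constant vector has energy 0, the least possible value, so it minimises the Rayleigh
  quotient.\<close>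

lemma laplacian_constant:
  assumes E: "simple_graph E" and w: "\<forall>e\<in>E. 0 \<le> w e"
  shows "laplacian E w *v 1 = 0"
proof -
  have "edge_energy 1 e = 0" if "e \<in> E" for e
    using E that unfolding simple_graph_def by (metis edge_energy_pair one_index diff_self zero_power2)
  then have "1 \<bullet> (laplacian E w *v 1) = 0 * (1 \<bullet> (1 :: real ^ 'a))"
    by (simp add: laplacian_quadratic_form[OF E])
  moreover have "0 * (x \<bullet> x) \<le> x \<bullet> (laplacian E w *v x)" for x
    using w edge_energy_nonneg[OF E] by (simp add: laplacian_quadratic_form[OF E] sum_nonneg)
  ultimately have "laplacian E w *v 1 = 0 *\<^sub>R 1"
    by (intro rayleigh_minimizer_is_eigenvector[of "(*v) (laplacian E w)" UNIV 0 1]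
        selfadjoint_matrix transpose_laplacian) auto
  then show ?thesis by simp
qed

text \<open>The constant vector \<open>1\<close> is an eigenvector for the lowest eigenvalue 0.\<close>

lemma second_laplacian_eigval:
  fixes E :: "'v::finite set set"
  assumes E: "simple_graph E" and w: "\<forall>e\<in>E. 0 \<le> w e" and n: "2 \<le> CARD('v)"
  shows "\<exists>x. norm x = 1 \<and> 1 \<bullet> x = 0 \<and> (\<Sum>e\<in>E. w e * edge_energy x e) = eigval (laplacian E w) 2"
    and "1 \<bullet> x = 0 \<Longrightarrow> eigval (laplacian E w) 2 * (x \<bullet> x) \<le> (\<Sum>e\<in>E. w e * edge_energy x e)"
proof -
  let ?A = "laplacian E w"
  have "(1 :: real ^ 'v) \<noteq> 0" by simp
  moreover have "?A *v 1 = 0 *\<^sub>R 1" by (simp add: laplacian_constant[OF E w])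
  moreover have "0 * (x \<bullet> x) \<le> x \<bullet> (?A *v x)" for x
    using w edge_energy_nonneg[OF E] by (simp add: laplacian_quadratic_form[OF E] sum_nonneg)
  ultimately have
    "\<exists>x. norm x = 1 \<and> 1 \<bullet> x = 0 \<and> x \<bullet> (?A *v x) = eigval ?A 2"
    "1 \<bullet> x = 0 \<Longrightarrow> eigval ?A 2 * (x \<bullet> x) \<le> x \<bullet> (?A *v x)"
    using second_eigval_variational[OF transpose_laplacian n, of 1 E w 0] by blast+
  then show "\<exists>x. norm x = 1 \<and> 1 \<bullet> x = 0 \<and> (\<Sum>e\<in>E. w e * edge_energy x e) = eigval ?A 2"
    and "1 \<bullet> x = 0 \<Longrightarrow> eigval ?A 2 * (x \<bullet> x) \<le> (\<Sum>e\<in>E. w e * edge_energy x e)"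
    by (simp_all add: laplacian_quadratic_form[OF E])
qed

lemma largest_laplacian_eigval:
  fixes E :: "'v::finite set set"
  assumes E: "simple_graph E"
  shows "\<exists>x. norm x = 1 \<and> (\<Sum>e\<in>E. w e * edge_energy x e) = eigval (laplacian E w) CARD('v)"
    and "(\<Sum>e\<in>E. w e * edge_energy x e) \<le> eigval (laplacian E w) CARD('v) * (x \<bullet> x)"
  using largest_eigval_variational[OF transpose_laplacian[of E w]]
  by (simp_all add: laplacian_quadratic_form[OF E])

lemma zero_energy_imp_constant:
  assumes conn: "connected_graph E" and zero: "\<And>e. e \<in> E \<Longrightarrow> edge_energy x e = 0"
  shows "x $ u = x $ v"
proof -
  have "(u, v) \<in> {(x, y). {x, y} \<in> E}\<^sup>*" using conn by (simp add: connected_graph_def)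
  then show ?thesis
  proof (induction rule: rtrancl_induct)
    case (step y z)
    then have "edge_energy x {y, z} = 0" using zero by blast
    then show ?case using step by (simp add: edge_energy_pair)
  qed simp
qed

text \<open>A unit vector of energy 0 would be constant by connectivity, hence could not be orthogonal
  to \<open>1\<close>.\<close>

lemma connected_imp_second_eigval_pos:
  fixes E :: "'v::finite set set"
  assumes E: "simple_graph E" and conn: "connected_graph E" and n: "2 \<le> CARD('v)"
  shows "0 < eigval (laplacian E unit_weight) 2"
proof (rule ccontr)
  assume np: "\<not> 0 < eigval (laplacian E unit_weight) 2"
  have w: "\<forall>e\<in>E. 0 \<le> unit_weight e" by (simp add: unit_weight_def)
  obtain x where x: "norm x = 1" "1 \<bullet> x = 0"
    "(\<Sum>e\<in>E. edge_energy x e) = eigval (laplacian E unit_weight) 2"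
    using second_laplacian_eigval(1)[where w = unit_weight, OF E w n] by (auto simp: unit_weight_def)
  then have "(\<Sum>e\<in>E. edge_energy x e) = 0"
    using np sum_nonneg[of E "edge_energy x"] edge_energy_nonneg[OF E, of _ x] by force
  then have "edge_energy x e = 0" if "e \<in> E" for e
    using that edge_energy_nonneg[OF E, of _ x] by (subst (asm) sum_nonneg_eq_0_iff) auto
  then have "x $ u = x $ v" for u v using zero_energy_imp_constant[OF conn] by blast
  then have "x = (x $ undefined) *\<^sub>R 1" by (simp add: vec_eq_iff)
  then have "x \<bullet> x = (x $ undefined) * (1 \<bullet> x)" by (metis inner_scaleR_left)
  then show False using x by (simp add: norm_eq_1)
qed

lemma second_le_largest_eigval:
  fixes E :: "'v::finite set set"
  assumes E: "simple_graph E" and n: "2 \<le> CARD('v)"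
  shows "eigval (laplacian E unit_weight) 2 \<le> eigval (laplacian E unit_weight) CARD('v)"
proof -
  have w: "\<forall>e\<in>E. 0 \<le> unit_weight e" by (simp add: unit_weight_def)
  obtain x where "norm x = 1"
    "(\<Sum>e\<in>E. unit_weight e * edge_energy x e) = eigval (laplacian E unit_weight) 2"
    using second_laplacian_eigval(1)[where w = unit_weight, OF E w n] by blast
  then show ?thesis
    using largest_laplacian_eigval(2)[OF E, of unit_weight x] by (simp add: norm_eq_1)
qed

lemma connected_imp_edges_nonempty:
  fixes E :: "'v::finite set set"
  assumes "connected_graph E" "2 \<le> CARD('v)"
  shows "E \<noteq> {}"
proof
  assume "E = {}"
  then have "u = v" for u v :: 'v using assms(1) by (simp add: connected_graph_def)
  then have "CARD('v) \<le> 1" by (intro card_le_Suc0_iff_eq[THEN iffD2, simplified One_nat_def[symmetric]]) auto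
  then show False using assms(2) by simp
qed

lemma eigenspace_edge_energy_sum:
  assumes E: "simple_graph E" and x: "norm x = 1" "x \<in> eigenspace (laplacian E w) \<mu>"
  shows "(\<Sum>e\<in>E. w e * edge_energy x e) = \<mu>"
proof -
  have "x \<bullet> (laplacian E w *v x) = \<mu>" using x by (simp add: eigenspace_def norm_eq_1)
  then show ?thesis by (simp add: laplacian_quadratic_form[OF E])
qed

section \<open>Certificates of conformal rigidity\<close>

text \<open>The mixture has energy \<open>c\<close> on every edge, so its total energy depends only on the total
  weight.\<close>

lemma average_weighted_energy_of_certificate:
  fixes E :: "'v::finite set set" and \<phi> :: "nat \<Rightarrow> real ^ 'v"
  assumes w: "(\<Sum>e\<in>E. w e) = real (card E)"
    and c: "\<forall>e\<in>E. c = (\<Sum>i=1..r. a i * edge_energy (\<phi> i) e)"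
  shows "(\<Sum>i=1..r. a i * (\<Sum>e\<in>E. w e * edge_energy (\<phi> i) e)) = c * real (card E)"
proof -
  have "(\<Sum>i=1..r. a i * (\<Sum>e\<in>E. w e * edge_energy (\<phi> i) e))
      = (\<Sum>e\<in>E. w e * (\<Sum>i=1..r. a i * edge_energy (\<phi> i) e))"
    unfolding sum_distrib_left by (subst sum.swap) (simp add: mult_ac)
  also have "\<dots> = (\<Sum>e\<in>E. w e * c)" using c by (intro sum.cong) auto
  also have "\<dots> = c * real (card E)" by (simp add: sum_distrib_right[symmetric] w)
  finally show ?thesis .
qed

text \<open>The right-hand side of both equivalences, with \<open>\<mu> = \<lambda>\<^sub>2\<close> or \<open>\<mu> = \<lambda>\<^sub>n\<close>.\<close>

definition rigidity_certificate ::
    "'v::finite set set \<Rightarrow> real \<Rightarrow> nat \<Rightarrow> (nat \<Rightarrow> real ^ 'v) \<Rightarrow> (nat \<Rightarrow> real) \<Rightarrow> real \<Rightarrow> bool" where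
  "rigidity_certificate E \<mu> r \<phi> a c \<longleftrightarrow>
     c > 0 \<and>
     (\<forall>i\<in>{1..r}. norm (\<phi> i) = 1 \<and> \<phi> i \<in> eigenspace (laplacian E unit_weight) \<mu>) \<and>
     (\<forall>i\<in>{1..r}. a i \<ge> 0) \<and> (\<Sum>i=1..r. a i) = 1 \<and>
     (\<forall>e\<in>E. c = (\<Sum>i=1..r. a i * edge_energy (\<phi> i) e))"

text \<open>Applying the averaging identity to unit weights determines \<open>c\<close>, since every \<open>\<phi>\<^sub>i\<close> has
  energy \<open>\<mu>\<close>.\<close>

lemma certificate_constant:
  assumes E: "simple_graph E" and C: "rigidity_certificate E \<mu> r \<phi> a c"
  shows "c * real (card E) = \<mu>"
proof -
  have "c * real (card E) = (\<Sum>i=1..r. a i * (\<Sum>e\<in>E. unit_weight e * edge_energy (\<phi> i) e))"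
    using C average_weighted_energy_of_certificate[where w = unit_weight and E = E and c = c and \<phi> = \<phi>]
    by (simp add: rigidity_certificate_def unit_weight_def)
  also have "\<dots> = (\<Sum>i=1..r. a i * \<mu>)"
    using C eigenspace_edge_energy_sum[OF E]
    by (intro sum.cong) (auto simp: rigidity_certificate_def)
  also have "\<dots> = \<mu>" using C by (simp add: sum_distrib_right[symmetric] rigidity_certificate_def)
  finally show ?thesis .
qed

text \<open>Connectivity enters through \<open>\<lambda>\<^sub>2 > 0\<close>: it makes the \<open>\<phi>\<^sub>i\<close> orthogonal to \<open>1\<close>, so that they are
  admissible test vectors for \<open>\<lambda>\<^sub>2(w)\<close>. That \<open>\<lambda>\<^sub>2(w)\<close> is at most each of their energies passes
  to the average, which is \<open>c \<cdot> |E| = \<lambda>\<^sub>2\<close>.\<close>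

lemma certificate_imp_lower_rigid:
  fixes E :: "'v::finite set set"
  assumes E: "simple_graph E" and conn: "connected_graph E" and n: "2 \<le> CARD('v)"
    and C: "rigidity_certificate E (eigval (laplacian E unit_weight) 2) r \<phi> a c"
  shows "lower_conformally_rigid E"
  unfolding lower_conformally_rigid_def
proof (intro allI impI)
  fix w assume w: "normalized_weight E w"
  let ?\<mu> = "eigval (laplacian E unit_weight) 2"
  have w0: "\<forall>e\<in>E. 0 \<le> w e" and ws: "(\<Sum>e\<in>E. w e) = real (card E)"
    using w by (auto simp: normalized_weight_def)
  have bound: "eigval (laplacian E w) 2 \<le> (\<Sum>e\<in>E. w e * edge_energy (\<phi> i) e)" if i: "i \<in> {1..r}" for i
  proof -
    have \<phi>: "norm (\<phi> i) = 1" "laplacian E unit_weight *v \<phi> i = ?\<mu> *\<^sub>R \<phi> i"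
      using C i by (auto simp: rigidity_certificate_def eigenspace_def)
    have "?\<mu> * (1 \<bullet> \<phi> i) = 1 \<bullet> (laplacian E unit_weight *v \<phi> i)" by (simp add: \<phi>(2))
    also have "\<dots> = 0"
      by (simp add: selfadjoint_matrix[OF transpose_laplacian] laplacian_constant[OF E] unit_weight_def)
    finally have "1 \<bullet> \<phi> i = 0" using connected_imp_second_eigval_pos[OF E conn n] by simp
    then show ?thesis using second_laplacian_eigval(2)[OF E w0 n, of "\<phi> i"] \<phi>(1)
      by (simp add: norm_eq_1)
  qed
  have "eigval (laplacian E w) 2 = (\<Sum>i=1..r. a i * eigval (laplacian E w) 2)"
    using C by (simp add: sum_distrib_right[symmetric] rigidity_certificate_def)
  also have "\<dots> \<le> (\<Sum>i=1..r. a i * (\<Sum>e\<in>E. w e * edge_energy (\<phi> i) e))"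
    using C by (intro sum_mono mult_left_mono bound) (auto simp: rigidity_certificate_def)
  also have "\<dots> = c * real (card E)"
    using C by (intro average_weighted_energy_of_certificate[OF ws]) (auto simp: rigidity_certificate_def)
  also have "\<dots> = ?\<mu>" using certificate_constant[OF E C] .
  finally show "eigval (laplacian E w) 2 \<le> ?\<mu>" .
qed

text \<open>The same average, now bounded above by \<open>\<lambda>\<^sub>n(w)\<close>, for which every unit vector is an admissible
  test vector.\<close>

lemma certificate_imp_upper_rigid:
  fixes E :: "'v::finite set set"
  assumes E: "simple_graph E"
    and C: "rigidity_certificate E (eigval (laplacian E unit_weight) CARD('v)) r \<phi> a c"
  shows "upper_conformally_rigid E"
  unfolding upper_conformally_rigid_def
proof (intro allI impI)
  fix w assume w: "normalized_weight E w"
  let ?v = "eigval (laplacian E w) CARD('v)"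
  have ws: "(\<Sum>e\<in>E. w e) = real (card E)" using w by (auto simp: normalized_weight_def)
  have bound: "(\<Sum>e\<in>E. w e * edge_energy (\<phi> i) e) \<le> ?v" if "i \<in> {1..r}" for i
    using largest_laplacian_eigval(2)[OF E, of w "\<phi> i"] C that
    by (simp add: norm_eq_1 rigidity_certificate_def)
  have "eigval (laplacian E unit_weight) CARD('v) = c * real (card E)"
    using certificate_constant[OF E C] by simp
  also have "\<dots> = (\<Sum>i=1..r. a i * (\<Sum>e\<in>E. w e * edge_energy (\<phi> i) e))"
    using C by (intro average_weighted_energy_of_certificate[OF ws, symmetric]) (auto simp: rigidity_certificate_def)
  also have "\<dots> \<le> (\<Sum>i=1..r. a i * ?v)"
    using C by (intro sum_mono mult_left_mono bound) (auto simp: rigidity_certificate_def)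
  also have "\<dots> = ?v"
    using C by (simp add: sum_distrib_right[symmetric] rigidity_certificate_def)
  finally show "eigval (laplacian E unit_weight) CARD('v) \<le> ?v" .
qed

text \<open>The alternative is applied to the unit vectors orthogonal to \<open>1\<close>. The vectors it returns attain
  the minimum \<open>\<lambda>\<^sub>2\<close> of the Rayleigh quotient on the invariant subspace \<open>1\<^sup>\<bottom>\<close>, hence are
  eigenvectors, and \<open>c = \<lambda>\<^sub>2 / |E|\<close> is positive by connectivity.\<close>

lemma lower_rigid_imp_certificate:
  fixes E :: "'v::finite set set"
  assumes E: "simple_graph E" and conn: "connected_graph E" and n: "2 \<le> CARD('v)"
    and rigid: "lower_conformally_rigid E"
  shows "\<exists>r \<phi> a c. rigidity_certificate E (eigval (laplacian E unit_weight) 2) r \<phi> a c"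
proof -
  let ?L = "laplacian E unit_weight"
  let ?\<mu> = "eigval ?L 2"
  let ?U = "{x. 1 \<bullet> x = 0} \<inter> sphere (0 :: real ^ 'v) 1"
  have w1: "\<forall>e\<in>E. 0 \<le> unit_weight e" by (simp add: unit_weight_def)
  have ne: "E \<noteq> {}" using connected_imp_edges_nonempty[OF conn n] .
  have U: "compact ?U" by (intro closed_Int_compact closed_hyperplane) auto
  have lb: "?\<mu> * (x \<bullet> x) \<le> (\<Sum>e\<in>E. edge_energy x e)" if "1 \<bullet> x = 0" for x
    using second_laplacian_eigval(2)[where w = unit_weight, OF E w1 n that] by (simp add: unit_weight_def)
  have lbU: "?\<mu> \<le> (\<Sum>e\<in>E. edge_energy x e)" if "x \<in> ?U" for x
    using lb[of x] that by (simp add: power2_norm_eq_inner[symmetric])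
  have opt: "\<exists>x\<in>?U. (\<Sum>e\<in>E. w e * edge_energy x e) \<le> ?\<mu>"
    if w: "\<forall>e\<in>E. 0 \<le> w e" "(\<Sum>e\<in>E. w e) = real (card E)" for w
  proof -
    have "eigval (laplacian E w) 2 \<le> ?\<mu>"
      using rigid w by (auto simp: lower_conformally_rigid_def normalized_weight_def)
    moreover obtain x where "norm x = 1" "1 \<bullet> x = 0"
      "(\<Sum>e\<in>E. w e * edge_energy x e) = eigval (laplacian E w) 2"
      using second_laplacian_eigval(1)[OF E w(1) n] by blast
    ultimately show ?thesis by (intro bexI[of _ x]) simp_all
  qed
  obtain r :: nat and \<phi> a where cert:
    "\<forall>j\<in>{1..r}. \<phi> j \<in> ?U \<and> (\<Sum>e\<in>E. edge_energy (\<phi> j) e) = ?\<mu>"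
    "\<forall>j\<in>{1..r}. 0 \<le> a j" "(\<Sum>j=1..r. a j) = 1"
    "\<forall>e\<in>E. ?\<mu> / real (card E) = (\<Sum>j=1..r. a j * edge_energy (\<phi> j) e)"
    by (rule equal_weights_optimal_imp_balanced
          [OF U continuous_on_edge_energy[OF E] ne lbU opt]) blast+
  have "\<phi> j \<in> eigenspace ?L ?\<mu>" if j: "j \<in> {1..r}" for j
  proof -
    let ?T = "{y \<in> UNIV. 1 \<bullet> y = (0 :: real)}"
    have inv: "(*v) ?L ` ?T \<subseteq> ?T"
      using laplacian_constant[OF E w1]
      by (intro invariant_orthogonal_complement[where \<mu> = 0] selfadjoint_matrix[OF transpose_laplacian]) auto
    have "?L *v \<phi> j = ?\<mu> *\<^sub>R \<phi> j"
    proof (rule rayleigh_minimizer_is_eigenvector[OF _ selfadjoint_matrix[OF transpose_laplacian]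
          subspace_orthogonal_complement_in[OF subspace_UNIV] inv])
      show "?\<mu> * (y \<bullet> y) \<le> y \<bullet> (?L *v y)" if "y \<in> ?T" for y
        using lb[of y] that by (simp add: laplacian_quadratic_form[OF E] unit_weight_def)
      show "\<phi> j \<bullet> (?L *v \<phi> j) = ?\<mu> * (\<phi> j \<bullet> \<phi> j)"
        using cert(1) j by (simp add: laplacian_quadratic_form[OF E] unit_weight_def norm_eq_1)
    qed (use cert(1) j in auto)
    then show ?thesis by (simp add: eigenspace_def)
  qed
  moreover have "0 < ?\<mu> / real (card E)"
    using connected_imp_second_eigval_pos[OF E conn n] ne by (simp add: card_gt_0_iff)
  ultimately have "rigidity_certificate E ?\<mu> r \<phi> a (?\<mu> / real (card E))"
    using cert by (auto simp: rigidity_certificate_def)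
  then show ?thesis by blast
qed

text \<open>Maximising the energy is minimising its negative: the alternative is applied to \<open>- \<ell>\<close> on the
  whole unit sphere, with \<open>m = - \<lambda>\<^sub>n\<close>, and the eigenvector criterion to \<open>- L\<close>. Positivity of \<open>c\<close>
  follows from \<open>\<lambda>\<^sub>n \<ge> \<lambda>\<^sub>2 > 0\<close>.\<close>

lemma upper_rigid_imp_certificate:
  fixes E :: "'v::finite set set"
  assumes E: "simple_graph E" and conn: "connected_graph E" and n: "2 \<le> CARD('v)"
    and rigid: "upper_conformally_rigid E"
  shows "\<exists>r \<phi> a c. rigidity_certificate E (eigval (laplacian E unit_weight) CARD('v)) r \<phi> a c"
proof -
  let ?L = "laplacian E unit_weight"
  let ?\<mu> = "eigval ?L CARD('v)"
  let ?U = "sphere (0 :: real ^ 'v) 1"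
  have ne: "E \<noteq> {}" using connected_imp_edges_nonempty[OF conn n] .
  have ub: "(\<Sum>e\<in>E. edge_energy x e) \<le> ?\<mu> * (x \<bullet> x)" for x
    using largest_laplacian_eigval(2)[OF E, of unit_weight x] by (simp add: unit_weight_def)
  have lbU: "- ?\<mu> \<le> (\<Sum>e\<in>E. - edge_energy x e)" if "x \<in> ?U" for x
    using ub[of x] that by (simp add: sum_negf power2_norm_eq_inner[symmetric])
  have opt: "\<exists>x\<in>?U. (\<Sum>e\<in>E. w e * - edge_energy x e) \<le> - ?\<mu>"
    if w: "\<forall>e\<in>E. 0 \<le> w e" "(\<Sum>e\<in>E. w e) = real (card E)" for w
  proof -
    have "?\<mu> \<le> eigval (laplacian E w) CARD('v)"
      using rigid w by (auto simp: upper_conformally_rigid_def normalized_weight_def)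
    moreover obtain x where "norm x = 1"
      "(\<Sum>e\<in>E. w e * edge_energy x e) = eigval (laplacian E w) CARD('v)"
      using largest_laplacian_eigval(1)[OF E, of w] by blast
    ultimately show ?thesis by (intro bexI[of _ x]) (simp_all add: sum_negf)
  qed
  obtain r :: nat and \<phi> a where cert:
    "\<forall>j\<in>{1..r}. \<phi> j \<in> ?U \<and> (\<Sum>e\<in>E. - edge_energy (\<phi> j) e) = - ?\<mu>"
    "\<forall>j\<in>{1..r}. 0 \<le> a j" "(\<Sum>j=1..r. a j) = 1"
    "\<forall>e\<in>E. - ?\<mu> / real (card E) = (\<Sum>j=1..r. a j * - edge_energy (\<phi> j) e)"
    by (rule equal_weights_optimal_imp_balanced
          [OF compact_sphere continuous_on_minus[OF continuous_on_edge_energy[OF E]] ne lbU opt]) blast+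
  have "\<phi> j \<in> eigenspace ?L ?\<mu>" if j: "j \<in> {1..r}" for j
  proof -
    have "- (?L *v \<phi> j) = - ?\<mu> *\<^sub>R \<phi> j"
    proof (rule rayleigh_minimizer_is_eigenvector[where f = "\<lambda>x. - (?L *v x)", OF _ _ subspace_UNIV])
      show "linear (\<lambda>x. - (?L *v x))" by (intro linear_compose_neg) simp
      show "- ?\<mu> * (y \<bullet> y) \<le> y \<bullet> - (?L *v y)" for y
        using ub[of y] by (simp add: laplacian_quadratic_form[OF E] unit_weight_def)
      show "\<phi> j \<bullet> - (?L *v \<phi> j) = - ?\<mu> * (\<phi> j \<bullet> \<phi> j)"
        using cert(1) j
        by (simp add: laplacian_quadratic_form[OF E] unit_weight_def norm_eq_1 sum_negf)
    qed (simp_all add: selfadjoint_matrix[OF transpose_laplacian])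
    then show ?thesis by (simp add: eigenspace_def)
  qed
  moreover have "0 < ?\<mu> / real (card E)"
    using connected_imp_second_eigval_pos[OF E conn n] second_le_largest_eigval[OF E n] ne
    by (simp add: card_gt_0_iff)
  moreover have "\<forall>e\<in>E. ?\<mu> / real (card E) = (\<Sum>j=1..r. a j * edge_energy (\<phi> j) e)"
    using cert(4) by (simp add: sum_negf)
  ultimately have "rigidity_certificate E ?\<mu> r \<phi> a (?\<mu> / real (card E))"
    using cert by (auto simp: rigidity_certificate_def)
  then show ?thesis by blast
qed

theorem theorem3p4:
  fixes E :: "'v::finite set set"
  assumes "simple_graph E" and "connected_graph E" and "CARD('v) \<ge> 2"
  shows "(lower_conformally_rigid E \<longleftrightarrow>
           (\<exists>(r::nat) (\<phi> :: nat \<Rightarrow> real ^ 'v) (a :: nat \<Rightarrow> real) (c :: real).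
              c > 0 \<and>
              (\<forall>i\<in>{1..r}. norm (\<phi> i) = 1 \<and>
                 \<phi> i \<in> eigenspace (laplacian E unit_weight) (eigval (laplacian E unit_weight) 2)) \<and>
              (\<forall>i\<in>{1..r}. a i \<ge> 0) \<and> (\<Sum>i=1..r. a i) = 1 \<and>
              (\<forall>e\<in>E. c = (\<Sum>i=1..r. a i * edge_energy (\<phi> i) e)))) \<and>
         (upper_conformally_rigid E \<longleftrightarrow>
           (\<exists>(r::nat) (\<phi> :: nat \<Rightarrow> real ^ 'v) (a :: nat \<Rightarrow> real) (c :: real).
              c > 0 \<and>
              (\<forall>i\<in>{1..r}. norm (\<phi> i) = 1 \<and>
                 \<phi> i \<in> eigenspace (laplacian E unit_weight) (eigval (laplacian E unit_weight) CARD('v))) \<and>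
              (\<forall>i\<in>{1..r}. a i \<ge> 0) \<and> (\<Sum>i=1..r. a i) = 1 \<and>
              (\<forall>e\<in>E. c = (\<Sum>i=1..r. a i * edge_energy (\<phi> i) e))))"
  unfolding rigidity_certificate_def[symmetric]
  using certificate_imp_lower_rigid[OF assms] lower_rigid_imp_certificate[OF assms]
    certificate_imp_upper_rigid[OF assms(1)] upper_rigid_imp_certificate[OF assms]
  by blast

end
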